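(* Let $E$ and $F$ be Banach spaces and let $1\le q,q_1,p,p_1,r,r_1<\infty$ with $r\le q$ and $r_1\le q_1$. (a) If $\Pi^{2}_{p,q;p,r}(F^*,E;\mathbb K)=\mathcal L(F^*,E;\mathbb K)$, then $W_{q,p;r}^{\mathrm{mid}}(E;F)=\mathcal L(E;F)$. (b) If $\Pi^{2}_{p,q;p,r}(F^*,E;\mathbb K)\subseteq\Pi^{2}_{p_1,q_1;p_1,r_1}(F^*,E;\mathbb K)$, then $W_{q,p;r}^{\mathrm{mid}}(E;F)\subseteq W_{q_1,p_1;r_1}^{\mathrm{mid}}(E;F)$.
   Context: Banach spaces are over $\mathbb K=\mathbb R$ or $\mathbb C$; $\mathcal L(E;F)$ is the space of continuous linear operators and $\mathcal L(E_1,E_2;\mathbb K)$ the space of continuous bilinear forms on $E_1\times E_2$. For $1\le p<\infty$, $\ell_p^w(E)$ is the space of sequences $(x_j)_{j=1}^\infty$ in $E$ with $\|(x_j)_j\|_{w,p}:=\sup_{\varphi\in B_{E^*}}(\sum_{j}|\varphi(x_j)|^p)^{1/p}<\infty$. A form $A\in\mathcal L(E_1,E_2;\mathbb K)$ is multiple $(q_1,q_2;p_1,p_2)$-summing, written $A\in\Pi^2_{q_1,q_2;p_1,p_2}(E_1,E_2;\mathbb K)$, if there is $C>0$ with $$\left(\sum_{j_2=1}^\infty\left(\sum_{j_1=1}^\infty|A(x^{(1)}_{j_1},x^{(2)}_{j_2})|^{q_1}\right)^{q_2/q_1}\right)^{1/q_2}\le C\,\|(x^{(1)}_{j})_{j}\|_{w,p_1}\|(x^{(2)}_{j})_{j}\|_{w,p_2}$$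 for all $(x^{(i)}_j)_j\in\ell_{p_i}^w(E_i)$, $i=1,2$. For $1\le q,p<\infty$, $\ell_{q,p}^{\mathrm{mid}}(F)$ is the space of sequences $(y_j)_{j=1}^\infty$ in $F$ with $\sum_{j=1}^\infty\left(\sum_{n=1}^\infty|y_n^*(y_j)|^p\right)^{q/p}<\infty$ for every $(y_n^* )_n\in\ell_p^w(F^* )$. For $1\le r\le q<\infty$, $W_{q,p;r}^{\mathrm{mid}}(E;F)$ is the set of $T\in\mathcal L(E;F)$ such that $(T(x_j))_j\in\ell_{q,p}^{\mathrm{mid}}(F)$ whenever $(x_j)_j\in\ell_r^w(E)$. *)

theory Defs
  imports "HOL-Analysis.Analysis"
begin

(* The scalar field K: up to an isometric field isomorphism, exactly the real or the complex
   numbers. *)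

class real_or_complex = real_normed_field +
  assumes real_or_complex:
    "(\<exists>h :: 'a \<Rightarrow> real. bij h \<and> (\<forall>x y. h (x + y) = h x + h y) \<and>
        (\<forall>x y. h (x * y) = h x * h y) \<and> (\<forall>x. norm (h x) = norm x)) \<or>
     (\<exists>h :: 'a \<Rightarrow> complex. bij h \<and> (\<forall>x y. h (x + y) = h x + h y) \<and>
        (\<forall>x y. h (x * y) = h x * h y) \<and> (\<forall>x. norm (h x) = norm x))"

instance real :: real_or_complex
  by standard (intro disjI1 exI[of _ "\<lambda>x. x"], simp add: bij_def)

instance complex :: real_or_complex
  by standard (intro disjI2 exI[of _ "\<lambda>x. x"], simp add: bij_def)

(* A Banach space over K is a real Banach space (the class banach) whose real structure is
   extended by a scalar multiplication of K for which the norm is homogeneous. *)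

locale banach_over = vector_space scale
  for scale :: "'k::real_or_complex \<Rightarrow> 'a::banach \<Rightarrow> 'a" +
  assumes scale_of_real: "scale (of_real r) x = r *\<^sub>R x"
    and norm_scale: "norm (scale c x) = norm c * norm x"

lemma banach_over_real: "banach_over ((*\<^sub>R) :: real \<Rightarrow> 'a::banach \<Rightarrow> 'a)"
  by unfold_locales (auto simp: algebra_simps)

lemma banach_over_complex: "banach_over ((*) :: complex \<Rightarrow> complex \<Rightarrow> complex)"
  by unfold_locales (auto simp: algebra_simps norm_mult scaleR_conv_of_real)

(* L(E;F).  The library type of bounded operators only records real-linearity. *)

definition operators ::
  "('k::real_or_complex \<Rightarrow> 'a::real_normed_vector \<Rightarrow> 'a) \<Rightarrow>
   ('k \<Rightarrow> 'b::real_normed_vector \<Rightarrow> 'b) \<Rightarrow> ('a \<Rightarrow>\<^sub>L 'b) set" where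
  "operators sE sF = {T. \<forall>c x. blinfun_apply T (sE c x) = sF c (blinfun_apply T x)}"

(* F* is the subspace of K-linear elements of the normed space of bounded real-linear maps F -> K,
   with the operator norm of that type and the pointwise scalar multiplication. *)

definition dual ::
  "('k::real_or_complex \<Rightarrow> 'b::real_normed_vector \<Rightarrow> 'b) \<Rightarrow> ('b \<Rightarrow>\<^sub>L 'k) set" where
  "dual sF = operators sF (*)"

definition dual_scale ::
  "'k::real_or_complex \<Rightarrow> ('b::real_normed_vector \<Rightarrow>\<^sub>L 'k) \<Rightarrow> ('b \<Rightarrow>\<^sub>L 'k)" where
  "dual_scale c \<phi> = blinfun_mult_right c o\<^sub>L \<phi>"

lemma dual_scale_apply: "blinfun_apply (dual_scale c \<phi>) y = c * blinfun_apply \<phi> y"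
  by (simp add: dual_scale_def)

lemma dual_closed:
  "0 \<in> dual sF"
  "\<phi> \<in> dual sF \<Longrightarrow> \<psi> \<in> dual sF \<Longrightarrow> \<phi> + \<psi> \<in> dual sF"
  "\<phi> \<in> dual sF \<Longrightarrow> dual_scale c \<phi> \<in> dual sF"
  by (auto simp: dual_def operators_def dual_scale_apply blinfun.add_left algebra_simps)

(* Since F* is a proper subset of its ambient type in general, the notions below take a normed
   space over K as a carrier set V together with its scalar multiplication s.
   For E and F the carrier is UNIV. *)

(* The closed unit ball of the dual of V: |phi x| <= |x| on V says that phi has norm at most 1. *)
definition dual_ball ::
  "'a::real_normed_vector set \<Rightarrow> ('k::real_or_complex \<Rightarrow> 'a \<Rightarrow> 'a) \<Rightarrow> ('a \<Rightarrow> 'k) set" where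
  "dual_ball V s = {\<phi>. (\<forall>x\<in>V. \<forall>y\<in>V. \<phi> (x + y) = \<phi> x + \<phi> y) \<and>
     (\<forall>c. \<forall>x\<in>V. \<phi> (s c x) = c * \<phi> x) \<and> (\<forall>x\<in>V. norm (\<phi> x) \<le> norm x)}"

(* Powers with real exponent a > 0 on [0, infinity]. *)
definition epow :: "ennreal \<Rightarrow> real \<Rightarrow> ennreal" where
  "epow t a = (if t = \<infinity> then \<infinity> else ennreal (enn2real t powr a))"

definition weak_norm ::
  "'a::real_normed_vector set \<Rightarrow> ('k::real_or_complex \<Rightarrow> 'a \<Rightarrow> 'a) \<Rightarrow> real \<Rightarrow> (nat \<Rightarrow> 'a) \<Rightarrow> ennreal"
  where
  "weak_norm V s p x =
     (SUP \<phi>\<in>dual_ball V s. epow (\<Sum>j. ennreal (norm (\<phi> (x j)) powr p)) (1 / p))"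

definition ell_weak ::
  "'a::real_normed_vector set \<Rightarrow> ('k::real_or_complex \<Rightarrow> 'a \<Rightarrow> 'a) \<Rightarrow> real \<Rightarrow> (nat \<Rightarrow> 'a) set" where
  "ell_weak V s p = {x. (\<forall>j. x j \<in> V) \<and> weak_norm V s p x < \<infinity>}"

(* Forms on V1 x V2 are extensional functions on the ambient product type: their value off the
   carrier is fixed, so that distinct elements are distinct forms. *)
definition bilinear_forms ::
  "'a::real_normed_vector set \<Rightarrow> ('k::real_or_complex \<Rightarrow> 'a \<Rightarrow> 'a) \<Rightarrow>
   'b::real_normed_vector set \<Rightarrow> ('k \<Rightarrow> 'b \<Rightarrow> 'b) \<Rightarrow> ('a \<times> 'b \<Rightarrow> 'k) set" where
  "bilinear_forms V1 s1 V2 s2 = {A \<in> extensional (V1 \<times> V2).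
     (\<forall>x\<in>V1. \<forall>x'\<in>V1. \<forall>y\<in>V2. A (x + x', y) = A (x, y) + A (x', y)) \<and>
     (\<forall>x\<in>V1. \<forall>y\<in>V2. \<forall>y'\<in>V2. A (x, y + y') = A (x, y) + A (x, y')) \<and>
     (\<forall>c. \<forall>x\<in>V1. \<forall>y\<in>V2. A (s1 c x, y) = c * A (x, y)) \<and>
     (\<forall>c. \<forall>x\<in>V1. \<forall>y\<in>V2. A (x, s2 c y) = c * A (x, y)) \<and>
     continuous_on (V1 \<times> V2) A}"

(* Multiple (q1,q2;p1,p2)-summing forms; the inner sum runs over the first variable. *)
definition multiple_summing ::
  "real \<Rightarrow> real \<Rightarrow> real \<Rightarrow> real \<Rightarrow>
   'a::real_normed_vector set \<Rightarrow> ('k::real_or_complex \<Rightarrow> 'a \<Rightarrow> 'a) \<Rightarrow>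
   'b::real_normed_vector set \<Rightarrow> ('k \<Rightarrow> 'b \<Rightarrow> 'b) \<Rightarrow> ('a \<times> 'b \<Rightarrow> 'k) set" where
  "multiple_summing q1 q2 p1 p2 V1 s1 V2 s2 = {A \<in> bilinear_forms V1 s1 V2 s2.
     \<exists>C>0. \<forall>x\<in>ell_weak V1 s1 p1. \<forall>y\<in>ell_weak V2 s2 p2.
       epow (\<Sum>j2. epow (\<Sum>j1. ennreal (norm (A (x j1, y j2)) powr q1)) (q2 / q1)) (1 / q2)
         \<le> ennreal C * weak_norm V1 s1 p1 x * weak_norm V2 s2 p2 y}"

definition ell_mid ::
  "('k::real_or_complex \<Rightarrow> 'b::real_normed_vector \<Rightarrow> 'b) \<Rightarrow> real \<Rightarrow> real \<Rightarrow> (nat \<Rightarrow> 'b) set" where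
  "ell_mid sF q p = {y. \<forall>\<psi>\<in>ell_weak (dual sF) dual_scale p.
     (\<Sum>j. epow (\<Sum>n. ennreal (norm (blinfun_apply (\<psi> n) (y j)) powr p)) (q / p)) < \<infinity>}"

definition W_mid ::
  "('k::real_or_complex \<Rightarrow> 'a::real_normed_vector \<Rightarrow> 'a) \<Rightarrow>
   ('k \<Rightarrow> 'b::real_normed_vector \<Rightarrow> 'b) \<Rightarrow> real \<Rightarrow> real \<Rightarrow> real \<Rightarrow> ('a \<Rightarrow>\<^sub>L 'b) set" where
  "W_mid sE sF q p r = {T \<in> operators sE sF.
     \<forall>x\<in>ell_weak UNIV sE r. (\<lambda>j. blinfun_apply T (x j)) \<in> ell_mid sF q p}"

end

theory Submission
  imports Defs
begin

text \<open>
  The bridge between the two classes is the form \<open>A\<^sub>T (\<phi>, x) = \<phi> (T x)\<close> on \<open>F\<^sup>* \<times> E\<close>: an operator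
  \<open>T\<close> belongs to \<open>W\<^sup>m\<^sup>i\<^sup>d\<close> for \<open>(q, p; r)\<close> exactly when \<open>A\<^sub>T\<close> is multiple \<open>(p, q; p, r)\<close>-summing
  (\<open>W_mid_iff_multiple_summing\<close>).  Both claims follow at once, since \<open>A\<^sub>T\<close> is a continuous bilinear
  form for every operator \<open>T\<close>.

  The two conditions differ only in that \<open>W\<^sup>m\<^sup>i\<^sup>d\<close> asks that certain iterated sums be finite, one
  pair of weakly summable sequences at a time, whereas summability of a form asks for a bound that
  is uniform in the pair.  For every bilinear form finiteness already implies uniformity
  (\<open>multiple_summing_iff_finite\<close>).  If no constant worked, homogeneity would give pairs
  \<open>(x\<^sup>k, y\<^sup>k)\<close> with weak norms at most \<open>2\<^sup>-\<^sup>k\<close> whose iterated sums have \<open>q\<close>-th roots at least \<open>k\<close>.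
  List the entries of all \<open>x\<^sup>k\<close> in a single sequence, and likewise those of all \<open>y\<^sup>k\<close>.  Both
  sequences are still weakly summable, because \<open>\<Sum>\<^sub>k 2\<^sup>-\<^sup>k\<^sup>p\<close> converges, and the iterated sum of the
  new pair dominates that of every \<open>(x\<^sup>k, y\<^sup>k)\<close>, since all terms are
  nonnegative; so it is infinite.
\<close>

section \<open>Powers of extended nonnegative reals\<close>

lemma epow_ennreal: "0 \<le> t \<Longrightarrow> epow (ennreal t) a = ennreal (t powr a)"
  by (simp add: epow_def)

lemma epow_less_top_iff: "epow t a < \<infinity> \<longleftrightarrow> t < \<infinity>"
  by (cases t) (auto simp: epow_def)

lemma epow_mono:
  assumes "s \<le> t" "0 \<le> a"
  shows "epow s a \<le> epow t a"
proof (cases t)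
  case (real v)
  with assms(1) obtain u where "s = ennreal u" "0 \<le> u"
    by (cases s) (auto simp: top_unique)
  with real assms show ?thesis
    by (auto simp: epow_ennreal intro!: ennreal_leI powr_mono2)
qed (simp add: epow_def)

lemma epow_mult: "epow (s * t) a = epow s a * epow t a"
proof (cases s; cases t)
  fix u v assume "s = ennreal u" "0 \<le> u" "t = ennreal v" "0 \<le> v"
  then show ?thesis
    by (simp add: epow_ennreal powr_mult flip: ennreal_mult)
next
  fix u assume "s = ennreal u" "0 \<le> u" "t = top"
  then show ?thesis
    by (cases "u = 0") (auto simp: epow_def ennreal_mult_top)
next
  fix v assume "s = top" "t = ennreal v" "0 \<le> v"
  then show ?thesis
    by (cases "v = 0") (auto simp: epow_def ennreal_top_mult)
qed (simp add: epow_def)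

lemma epow_epow: "epow (epow t a) b = epow t (a * b)"
  by (cases t) (auto simp: epow_def powr_powr)

lemma epow_1: "epow t 1 = t"
  by (cases t) (auto simp: epow_def)

lemma epow_root_le_iff:
  assumes "0 < a" "0 \<le> c"
  shows "epow t (1 / a) \<le> ennreal c \<longleftrightarrow> t \<le> ennreal (c powr a)"
proof
  assume "epow t (1 / a) \<le> ennreal c"
  from epow_mono[OF this, of a] assms show "t \<le> ennreal (c powr a)"
    by (simp add: epow_epow epow_1 epow_ennreal)
next
  assume "t \<le> ennreal (c powr a)"
  from epow_mono[OF this, of "1 / a"] assms show "epow t (1 / a) \<le> ennreal c"
    by (simp add: epow_ennreal powr_powr)
qed

lemma term_le_suminf_ennreal: "f k \<le> (\<Sum>i. f i)" for f :: "nat \<Rightarrow> ennreal"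
  using sum_le_suminf[of f "{k}"] by simp

section \<open>Weakly summable sequences\<close>

lemma weak_norm_le_iff:
  assumes "0 < p" "0 \<le> c"
  shows "weak_norm V s p x \<le> ennreal c \<longleftrightarrow>
    (\<forall>\<phi>\<in>dual_ball V s. (\<Sum>j. ennreal (norm (\<phi> (x j)) powr p)) \<le> ennreal (c powr p))"
  unfolding weak_norm_def SUP_le_iff by (simp add: epow_root_le_iff assms)

lemma weak_norm_scale:
  assumes "\<And>j. x j \<in> V" and "0 < p"
  shows "weak_norm V s p (\<lambda>j. s c (x j)) = ennreal (norm c) * weak_norm V s p x"
proof -
  have "epow (\<Sum>j. ennreal (norm (\<phi> (s c (x j))) powr p)) (1 / p) =
      ennreal (norm c) * epow (\<Sum>j. ennreal (norm (\<phi> (x j)) powr p)) (1 / p)"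
    if "\<phi> \<in> dual_ball V s" for \<phi>
  proof -
    have "\<phi> (s c (x j)) = c * \<phi> (x j)" for j
      using that assms(1) by (auto simp: dual_ball_def)
    then show ?thesis
      using assms(2)
      by (simp add: norm_mult powr_mult ennreal_mult epow_mult epow_ennreal powr_powr)
  qed
  then show ?thesis
    unfolding weak_norm_def by (simp add: SUP_mult_left_ennreal cong: SUP_cong)
qed

lemma ell_weak_scale:
  assumes "x \<in> ell_weak V s p" "0 < p" "\<And>v. v \<in> V \<Longrightarrow> s c v \<in> V"
  shows "(\<lambda>j. s c (x j)) \<in> ell_weak V s p"
  using assms by (auto simp: ell_weak_def weak_norm_scale ennreal_mult_less_top)

definition amalgam :: "(nat \<Rightarrow> nat \<Rightarrow> 'a) \<Rightarrow> nat \<Rightarrow> 'a" where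
  "amalgam x i = (case prod_decode i of (k, j) \<Rightarrow> x k j)"

lemma suminf_amalgam:
  fixes f :: "'a \<Rightarrow> ennreal"
  shows "(\<Sum>i. f (amalgam x i)) = (\<Sum>k. \<Sum>j. f (x k j))"
  using suminf_ennreal_2dimen[of "\<lambda>k. \<Sum>j. f (x k j)" "\<lambda>(k, j). f (x k j)"]
  by (simp add: amalgam_def split_beta)

text \<open>
  For a functional in the dual ball, the \<open>k\<close>-th sequence contributes at most \<open>2\<^sup>-\<^sup>k\<^sup>p \<le> 2\<^sup>-\<^sup>k\<close> to the
  sum of \<open>p\<close>-th powers, so the total is at most \<open>2\<close> for every functional.
\<close>

lemma ell_weak_amalgam:
  assumes "1 \<le> p" and x: "\<And>k. x k \<in> ell_weak V s p"
    and le: "\<And>k. weak_norm V s p (x k) \<le> ennreal ((1/2) ^ k)"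
  shows "amalgam x \<in> ell_weak V s p"
proof -
  have "(\<Sum>i. ennreal (norm (\<phi> (amalgam x i)) powr p)) \<le> ennreal ((2 powr (1 / p)) powr p)"
    if \<phi>: "\<phi> \<in> dual_ball V s" for \<phi>
  proof -
    have "(\<Sum>j. ennreal (norm (\<phi> (x k j)) powr p)) \<le> ennreal ((1/2) ^ k)" for k
    proof -
      have "(\<Sum>j. ennreal (norm (\<phi> (x k j)) powr p)) \<le> ennreal (((1/2) ^ k) powr p)"
        using le[of k] \<phi> assms(1) by (subst (asm) weak_norm_le_iff) auto
      also have "\<dots> \<le> ennreal (((1/2) ^ k) powr 1)"
        using assms(1) by (intro ennreal_leI powr_mono') (auto simp: power_le_one)
      also have "((1/2::real) ^ k) powr 1 = (1/2) ^ k"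
        by (subst powr_one) auto
      finally show ?thesis .
    qed
    then have "(\<Sum>k. \<Sum>j. ennreal (norm (\<phi> (x k j)) powr p)) \<le> (\<Sum>k. ennreal ((1/2) ^ k))"
      by (intro suminf_le) auto
    also have "\<dots> = ennreal 2"
      by (subst suminf_ennreal2) (simp_all add: suminf_geometric)
    finally show ?thesis
      using assms(1) by (subst suminf_amalgam) (simp add: powr_powr)
  qed
  then have "weak_norm V s p (amalgam x) \<le> ennreal (2 powr (1 / p))"
    using assms(1) by (subst weak_norm_le_iff) auto
  then have "weak_norm V s p (amalgam x) < \<infinity>"
    by (rule le_less_trans) simp
  moreover have "amalgam x i \<in> V" for i
    using x by (auto simp: amalgam_def ell_weak_def split: prod.split)
  ultimately show ?thesis
    by (simp add: ell_weak_def)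
qed

section \<open>Multiple summing forms\<close>

definition mixed_sum ::
  "real \<Rightarrow> real \<Rightarrow> ('a \<times> 'b \<Rightarrow> 'k::real_normed_vector) \<Rightarrow> (nat \<Rightarrow> 'a) \<Rightarrow> (nat \<Rightarrow> 'b) \<Rightarrow> ennreal"
  where
  "mixed_sum q1 q2 A x y =
     (\<Sum>j2. epow (\<Sum>j1. ennreal (norm (A (x j1, y j2)) powr q1)) (q2 / q1))"

lemma mixed_sum_scale:
  assumes A: "A \<in> bilinear_forms V1 s1 V2 s2" and "0 < q1" "0 < q2"
    and x: "\<And>j. x j \<in> V1" and y: "\<And>j. y j \<in> V2" and s1: "\<And>v. v \<in> V1 \<Longrightarrow> s1 c v \<in> V1"
  shows "epow (mixed_sum q1 q2 A (\<lambda>j. s1 c (x j)) (\<lambda>j. s2 d (y j))) (1 / q2) =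
    ennreal (norm c * norm d) * epow (mixed_sum q1 q2 A x y) (1 / q2)"
proof -
  have "A (s1 c (x i), s2 d (y j)) = d * (c * A (x i, y j))" for i j
    using A x y s1 by (auto simp: bilinear_forms_def)
  then have "norm (A (s1 c (x i), s2 d (y j))) powr q1 =
      (norm c * norm d) powr q1 * norm (A (x i, y j)) powr q1" for i j
    by (simp add: norm_mult powr_mult mult_ac)
  then show ?thesis
    using assms(2,3)
    by (simp add: mixed_sum_def ennreal_mult epow_mult epow_ennreal powr_powr)
qed

text \<open>
  The terms of the \<open>k\<close>-th pair occur among those of the amalgamated pair: each inner sum can only
  grow when further vectors join the first sequence, and the outer sum gains further terms.
\<close>

lemma mixed_sum_le_amalgam:
  assumes "0 < q1" "0 < q2"
  shows "mixed_sum q1 q2 A (x k) (y k) \<le> mixed_sum q1 q2 A (amalgam x) (amalgam y)"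
proof -
  let ?g = "\<lambda>v. epow (\<Sum>i. ennreal (norm (A (amalgam x i, v)) powr q1)) (q2 / q1)"
  have inner: "epow (\<Sum>j1. ennreal (norm (A (x k j1, v)) powr q1)) (q2 / q1) \<le> ?g v" for v
  proof (rule epow_mono)
    show "(\<Sum>j1. ennreal (norm (A (x k j1, v)) powr q1)) \<le>
        (\<Sum>i. ennreal (norm (A (amalgam x i, v)) powr q1))"
      by (subst suminf_amalgam[of "\<lambda>u. ennreal (norm (A (u, v)) powr q1)"])
        (rule term_le_suminf_ennreal)
  qed (use assms in simp)
  have "mixed_sum q1 q2 A (x k) (y k) \<le> (\<Sum>j. ?g (y k j))"
    unfolding mixed_sum_def by (intro suminf_le inner) auto
  also have "\<dots> \<le> (\<Sum>k. \<Sum>j. ?g (y k j))"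
    by (rule term_le_suminf_ennreal)
  also have "\<dots> = mixed_sum q1 q2 A (amalgam x) (amalgam y)"
    by (simp add: mixed_sum_def suminf_amalgam[of ?g])
  finally show ?thesis .
qed

text \<open>
  The numbers \<open>u\<close> and \<open>v\<close> are the weak norms of a pair violating the summability inequality, and
  \<open>a\<close> and \<open>b\<close> are the factors that rescale its sequences.  A weak norm may vanish; then the
  corresponding sequence can be enlarged at no cost.
\<close>

lemma obtain_rescaling:
  fixes u v N e K :: real
  assumes "0 \<le> u" "0 \<le> v" "0 < e" "0 < K" and N: "K / (e * e) * u * v < N"
  obtains a b where "0 < a" "0 < b" "a * u \<le> e" "b * v \<le> e" "K \<le> a * b * N"
proof -
  have "0 \<le> K / (e * e) * u * v"
    using assms by simp
  with N have "0 < N" by linarith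
  consider "u = 0" | "v = 0" | "0 < u" "0 < v"
    using assms by linarith
  then show thesis
  proof cases
    case 1
    show ?thesis
    proof (rule that[of "K / (e / (v + 1) * N)" "e / (v + 1)"])
      show "e / (v + 1) * v \<le> e"
        using assms by (simp add: field_simps)
    qed (use assms 1 \<open>0 < N\<close> in auto)
  next
    case 2
    show ?thesis
    proof (rule that[of "e / (u + 1)" "K / (e / (u + 1) * N)"])
      show "e / (u + 1) * u \<le> e"
        using assms by (simp add: field_simps)
    qed (use assms 2 \<open>0 < N\<close> in auto)
  next
    case 3
    show ?thesis
    proof (rule that[of "e / u" "e / v"])
      show "K \<le> e / u * (e / v) * N"
        using N assms 3 by (simp add: field_simps)
    qed (use assms 3 in auto)
  qed
qed

text \<open>
  Finiteness for every single pair forces a uniform constant: pairs that violate larger and larger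
  constants, rescaled to weak norms at most \<open>2\<^sup>-\<^sup>k\<close>, amalgamate to a single pair of weakly summable
  sequences, and its mixed sum would exceed every bound.
\<close>

lemma epow_mixed_sum_bounded:
  fixes s1 :: "'k::real_or_complex \<Rightarrow> 'a::real_normed_vector \<Rightarrow> 'a"
    and s2 :: "'k \<Rightarrow> 'b::real_normed_vector \<Rightarrow> 'b"
  assumes A: "A \<in> bilinear_forms V1 s1 V2 s2"
    and exps: "1 \<le> q1" "1 \<le> q2" "1 \<le> p1" "1 \<le> p2"
    and s1: "\<And>c v. v \<in> V1 \<Longrightarrow> s1 c v \<in> V1" and s2: "\<And>c v. v \<in> V2 \<Longrightarrow> s2 c v \<in> V2"
    and fin: "\<And>x y. x \<in> ell_weak V1 s1 p1 \<Longrightarrow> y \<in> ell_weak V2 s2 p2 \<Longrightarrow>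
      mixed_sum q1 q2 A x y < \<infinity>"
  shows "\<exists>C>0. \<forall>x\<in>ell_weak V1 s1 p1. \<forall>y\<in>ell_weak V2 s2 p2.
    epow (mixed_sum q1 q2 A x y) (1 / q2) \<le>
      ennreal C * weak_norm V1 s1 p1 x * weak_norm V2 s2 p2 y"
proof (rule ccontr)
  assume unbounded: "\<not> ?thesis"
  have "\<exists>x\<in>ell_weak V1 s1 p1. \<exists>y\<in>ell_weak V2 s2 p2.
      weak_norm V1 s1 p1 x \<le> ennreal ((1/2) ^ k) \<and> weak_norm V2 s2 p2 y \<le> ennreal ((1/2) ^ k) \<and>
      ennreal (real (Suc k)) \<le> epow (mixed_sum q1 q2 A x y) (1 / q2)" for k
  proof -
    define e :: real where "e = (1/2) ^ k"
    have "0 < e" by (simp add: e_def)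
    \<comment> \<open>Rescaling a pair from weak norms \<open>u\<close>, \<open>v\<close> to \<open>e\<close>, \<open>e\<close> multiplies the root of its mixed sum
      by \<open>e * e / (u * v)\<close>, and the result must be at least \<open>k + 1\<close>.\<close>
    define C where "C = real (Suc k) / (e * e)"
    have "0 < C" using \<open>0 < e\<close> by (simp add: C_def)
    with unbounded obtain x y where x: "x \<in> ell_weak V1 s1 p1" and y: "y \<in> ell_weak V2 s2 p2"
      and gt: "ennreal C * weak_norm V1 s1 p1 x * weak_norm V2 s2 p2 y
        < epow (mixed_sum q1 q2 A x y) (1 / q2)"
      by (meson not_le)
    obtain u where u: "weak_norm V1 s1 p1 x = ennreal u" "0 \<le> u"
      using x by (cases "weak_norm V1 s1 p1 x") (auto simp: ell_weak_def)
    obtain v where v: "weak_norm V2 s2 p2 y = ennreal v" "0 \<le> v"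
      using y by (cases "weak_norm V2 s2 p2 y") (auto simp: ell_weak_def)
    have "epow (mixed_sum q1 q2 A x y) (1 / q2) < \<infinity>"
      using fin[OF x y] by (simp only: epow_less_top_iff)
    then obtain N where N: "epow (mixed_sum q1 q2 A x y) (1 / q2) = ennreal N" "0 \<le> N"
      by (cases "epow (mixed_sum q1 q2 A x y) (1 / q2)") auto
    have "C * u * v < N"
      using gt u v N \<open>0 < C\<close> by (simp add: ennreal_less_iff flip: ennreal_mult)
    then obtain a b where ab: "0 < a" "0 < b" "a * u \<le> e" "b * v \<le> e" "real (Suc k) \<le> a * b * N"
      unfolding C_def using obtain_rescaling[of u v e "real (Suc k)" N] u v \<open>0 < e\<close> by auto
    let ?x = "\<lambda>j. s1 (of_real a) (x j)" and ?y = "\<lambda>j. s2 (of_real b) (y j)"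
    have "weak_norm V1 s1 p1 ?x \<le> ennreal e" "weak_norm V2 s2 p2 ?y \<le> ennreal e"
      using x y exps ab u v
      by (auto simp: ell_weak_def weak_norm_scale intro!: ennreal_leI simp flip: ennreal_mult)
    moreover have "ennreal (real (Suc k)) \<le> epow (mixed_sum q1 q2 A ?x ?y) (1 / q2)"
    proof -
      have "epow (mixed_sum q1 q2 A ?x ?y) (1 / q2) = ennreal (a * b * N)"
        using x y exps ab N
        by (subst mixed_sum_scale[OF A])
          (auto simp: ell_weak_def s1 simp flip: ennreal_mult)
      with ab show ?thesis by (simp only: ennreal_leI)
    qed
    moreover have "?x \<in> ell_weak V1 s1 p1" "?y \<in> ell_weak V2 s2 p2"
      using x y exps s1 s2 by (auto intro!: ell_weak_scale)
    ultimately show ?thesis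
      unfolding e_def by blast
  qed
  then obtain x y where x: "\<And>k. x k \<in> ell_weak V1 s1 p1"
      "\<And>k. weak_norm V1 s1 p1 (x k) \<le> ennreal ((1/2) ^ k)"
    and y: "\<And>k. y k \<in> ell_weak V2 s2 p2" "\<And>k. weak_norm V2 s2 p2 (y k) \<le> ennreal ((1/2) ^ k)"
    and large: "\<And>k. ennreal (real (Suc k)) \<le> epow (mixed_sum q1 q2 A (x k) (y k)) (1 / q2)"
    by metis
  have "amalgam x \<in> ell_weak V1 s1 p1" "amalgam y \<in> ell_weak V2 s2 p2"
    using x y exps by (auto intro!: ell_weak_amalgam)
  then have "epow (mixed_sum q1 q2 A (amalgam x) (amalgam y)) (1 / q2) < \<infinity>"
    using fin by (simp only: epow_less_top_iff)
  then obtain N where N: "epow (mixed_sum q1 q2 A (amalgam x) (amalgam y)) (1 / q2) = ennreal N"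
    "0 \<le> N"
    by (cases "epow (mixed_sum q1 q2 A (amalgam x) (amalgam y)) (1 / q2)") auto
  obtain k where "N < real k"
    using reals_Archimedean2 by blast
  have "ennreal (real (Suc k)) \<le> epow (mixed_sum q1 q2 A (x k) (y k)) (1 / q2)"
    by (rule large)
  also have "\<dots> \<le> ennreal N"
    unfolding N(1)[symmetric] using exps by (intro epow_mono mixed_sum_le_amalgam) auto
  finally show False
    using \<open>N < real k\<close> N(2) by (simp del: of_nat_Suc)
qed

theorem multiple_summing_iff_finite:
  fixes s1 :: "'k::real_or_complex \<Rightarrow> 'a::real_normed_vector \<Rightarrow> 'a"
    and s2 :: "'k \<Rightarrow> 'b::real_normed_vector \<Rightarrow> 'b"
  assumes A: "A \<in> bilinear_forms V1 s1 V2 s2"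
    and exps: "1 \<le> q1" "1 \<le> q2" "1 \<le> p1" "1 \<le> p2"
    and s1: "\<And>c v. v \<in> V1 \<Longrightarrow> s1 c v \<in> V1" and s2: "\<And>c v. v \<in> V2 \<Longrightarrow> s2 c v \<in> V2"
  shows "A \<in> multiple_summing q1 q2 p1 p2 V1 s1 V2 s2 \<longleftrightarrow>
    (\<forall>x\<in>ell_weak V1 s1 p1. \<forall>y\<in>ell_weak V2 s2 p2. mixed_sum q1 q2 A x y < \<infinity>)"
proof
  assume "A \<in> multiple_summing q1 q2 p1 p2 V1 s1 V2 s2"
  then obtain C where C: "\<And>x y. x \<in> ell_weak V1 s1 p1 \<Longrightarrow> y \<in> ell_weak V2 s2 p2 \<Longrightarrow>
      epow (mixed_sum q1 q2 A x y) (1 / q2) \<le>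
        ennreal C * weak_norm V1 s1 p1 x * weak_norm V2 s2 p2 y"
    unfolding multiple_summing_def mixed_sum_def by blast
  show "\<forall>x\<in>ell_weak V1 s1 p1. \<forall>y\<in>ell_weak V2 s2 p2. mixed_sum q1 q2 A x y < \<infinity>"
  proof (intro ballI)
    fix x y assume xy: "x \<in> ell_weak V1 s1 p1" "y \<in> ell_weak V2 s2 p2"
    then have "ennreal C * weak_norm V1 s1 p1 x * weak_norm V2 s2 p2 y < \<infinity>"
      by (auto simp: ell_weak_def ennreal_mult_less_top)
    with C[OF xy] have "epow (mixed_sum q1 q2 A x y) (1 / q2) < \<infinity>"
      by (rule le_less_trans)
    then show "mixed_sum q1 q2 A x y < \<infinity>"
      by (simp only: epow_less_top_iff)
  qed
next
  assume "\<forall>x\<in>ell_weak V1 s1 p1. \<forall>y\<in>ell_weak V2 s2 p2. mixed_sum q1 q2 A x y < \<infinity>"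
  then show "A \<in> multiple_summing q1 q2 p1 p2 V1 s1 V2 s2"
    using epow_mixed_sum_bounded[OF A exps s1 s2] A
    unfolding multiple_summing_def mixed_sum_def by blast
qed

section \<open>The form of an operator\<close>

text \<open>The restriction makes the form extensional, as membership in \<open>bilinear_forms\<close> demands.\<close>

definition operator_form ::
  "('k::real_or_complex \<Rightarrow> 'f::real_normed_vector \<Rightarrow> 'f) \<Rightarrow>
   ('e::real_normed_vector \<Rightarrow>\<^sub>L 'f) \<Rightarrow> ('f \<Rightarrow>\<^sub>L 'k) \<times> 'e \<Rightarrow> 'k" where
  "operator_form sF T =
     restrict (\<lambda>(\<phi>, x). blinfun_apply \<phi> (blinfun_apply T x)) (dual sF \<times> UNIV)"

lemma operator_form_bilinear:
  assumes "T \<in> operators sE sF"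
  shows "operator_form sF T \<in> bilinear_forms (dual sF) dual_scale UNIV sE"
proof -
  have "continuous_on (dual sF \<times> UNIV) (operator_form sF T)"
  proof (subst continuous_on_cong[OF refl])
    show "continuous_on (dual sF \<times> UNIV)
        (\<lambda>z. blinfun_apply (fst z) (blinfun_apply T (snd z)))"
      by (intro continuous_intros)
  qed (auto simp: operator_form_def)
  moreover have "\<phi> (T (sE c x)) = c * \<phi> (T x)" if "\<phi> \<in> dual sF" for \<phi> c x
    using that assms by (auto simp: dual_def operators_def)
  ultimately show ?thesis
    by (auto simp: bilinear_forms_def operator_form_def dual_closed dual_scale_apply
        blinfun.add_left blinfun.add_right)
qed

text \<open>
  Unfolded, membership in \<open>W_mid\<close> says that all mixed sums of the form of \<open>T\<close> are finite, which
  is the criterion \<open>multiple_summing_iff_finite\<close> for that form.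
\<close>

lemma W_mid_iff_multiple_summing:
  fixes sE :: "'k::real_or_complex \<Rightarrow> 'e::real_normed_vector \<Rightarrow> 'e"
    and sF :: "'k \<Rightarrow> 'f::real_normed_vector \<Rightarrow> 'f"
  assumes T: "T \<in> operators sE sF" and "1 \<le> q" "1 \<le> p" "1 \<le> r"
  shows "T \<in> W_mid sE sF q p r \<longleftrightarrow>
    operator_form sF T \<in> multiple_summing p q p r (dual sF) dual_scale UNIV sE"
proof -
  have "mixed_sum p q (operator_form sF T) \<psi> x =
      (\<Sum>j. epow (\<Sum>n. ennreal (norm (\<psi> n (T (x j))) powr p)) (q / p))"
    if "\<psi> \<in> ell_weak (dual sF) dual_scale p" for \<psi> x
    using that by (simp add: mixed_sum_def operator_form_def ell_weak_def)
  then have "T \<in> W_mid sE sF q p r \<longleftrightarrow>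
      (\<forall>\<psi>\<in>ell_weak (dual sF) dual_scale p. \<forall>x\<in>ell_weak UNIV sE r.
        mixed_sum p q (operator_form sF T) \<psi> x < \<infinity>)"
    unfolding W_mid_def ell_mid_def using T by (simp cong: ball_cong) blast
  also have "\<dots> \<longleftrightarrow>
      operator_form sF T \<in> multiple_summing p q p r (dual sF) dual_scale UNIV sE"
    using assms(2-4)
    by (intro multiple_summing_iff_finite[OF operator_form_bilinear[OF T], symmetric])
      (simp_all add: dual_closed)
  finally show ?thesis .
qed

theorem corollary5p5:
  fixes sE :: "'k::real_or_complex \<Rightarrow> 'e::banach \<Rightarrow> 'e"
    and sF :: "'k \<Rightarrow> 'f::banach \<Rightarrow> 'f"
    and q q1 p p1 r r1 :: real
  assumes "banach_over sE" and "banach_over sF"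
    and "1 \<le> q" and "1 \<le> q1" and "1 \<le> p" and "1 \<le> p1" and "1 \<le> r" and "1 \<le> r1"
    and "r \<le> q" and "r1 \<le> q1"
  shows "(multiple_summing p q p r (dual sF) dual_scale UNIV sE
            = bilinear_forms (dual sF) dual_scale UNIV sE
          \<longrightarrow> W_mid sE sF q p r = operators sE sF)
       \<and> (multiple_summing p q p r (dual sF) dual_scale UNIV sE
            \<subseteq> multiple_summing p1 q1 p1 r1 (dual sF) dual_scale UNIV sE
          \<longrightarrow> W_mid sE sF q p r \<subseteq> W_mid sE sF q1 p1 r1)"
proof -
  have sub: "W_mid sE sF q p r \<subseteq> operators sE sF"
    by (auto simp: W_mid_def)
  have iff: "T \<in> W_mid sE sF q p r \<longleftrightarrow>
      operator_form sF T \<in> multiple_summing p q p r (dual sF) dual_scale UNIV sE"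
    and iff1: "T \<in> W_mid sE sF q1 p1 r1 \<longleftrightarrow>
      operator_form sF T \<in> multiple_summing p1 q1 p1 r1 (dual sF) dual_scale UNIV sE"
    if "T \<in> operators sE sF" for T
    by (rule W_mid_iff_multiple_summing; fact)+
  show ?thesis
  proof (intro conjI impI)
    assume "multiple_summing p q p r (dual sF) dual_scale UNIV sE
      = bilinear_forms (dual sF) dual_scale UNIV sE"
    with iff operator_form_bilinear have "operators sE sF \<subseteq> W_mid sE sF q p r"
      by fast
    with sub show "W_mid sE sF q p r = operators sE sF"
      by (rule subset_antisym)
  next
    assume "multiple_summing p q p r (dual sF) dual_scale UNIV sE
      \<subseteq> multiple_summing p1 q1 p1 r1 (dual sF) dual_scale UNIV sE"
    with sub iff iff1 show "W_mid sE sF q p r \<subseteq> W_mid sE sF q1 p1 r1"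
      by blast
  qed
qed

end
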